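(* Let $G$ be a finite connected graph with $n$ vertices. For the all-singleton oriented partition of $G$ (each edge is its own class, with a chosen direction), $\Gamma_{\mathrm{univ}}\cong\mathbb{Z}^{\,n-1}$ and the quotient labeling $\phi$ is isometric on all pairs, with the infinite host $\mathrm{Cay}(\mathbb{Z}^{\,n-1},S\cup -S)$: $d_{\mathrm{Cay}}(\phi(u),\phi(v))=d_G(u,v)$ for all $u,v\in V(G)$.
   Context: $d_G$ is the shortest-path metric. An oriented partition of $G$ is a partition $\{F_1,\dots,F_t\}$ of $E(G)$ together with a chosen (forward) direction for each edge. Fix a cycle basis $B_1,\dots,B_c$ of $G$ whose signed edge-incidence vectors form a $\mathbb{Z}$-basis of the integer cycle lattice (the kernel of $\mathbb{Z}^E\to\mathbb{Z}^V$, $(u\to v)\mapsto\delta_v-\delta_u$). The signed cycle–class matrix $A\in\mathbb{Z}^{c\times t}$ has $A[i,j]$ equal to the net signed number of crossings of $F_j$ by $B_i$ (forward $+1$, backward $-1$). The universal group is $\Gamma_{\mathrm{univ}}=\mathbb{Z}^t/\mathrm{rowlattice}(A)$, $g_j$ is the image of the $j$-th standard basis vector, and the quotient labeling is $\phi(v)=\sum_{e\in P(r,v)}\pm g_{\mathrm{class}(e)}$ along any path from a fixed root $r$ to $v$ (sign $+$ for forward traversal, $-$ for backward; path-independent), where $\mathrm{class}(e)=j$ if $e\in F_j$. $S$ is the set of nonzero $g_j$; $\mathrm{Cay}(\Gamma,S\cup -S)$ is the graph on $\Gamma$ with edges $\{h,h+s\}$, $s\in S\cup -S$, and $d_{\mathrm{Cay}}$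 is its graph metric. *)

theory Defs
  imports
    "Graph_Theory.Pair_Digraph"
    "Graph_Theory.Digraph_Component"
    "Graph_Theory.Shortest_Path"
    "HOL-Algebra.Product_Groups"
    "HOL-Algebra.Coset"
    "HOL-Library.Disjoint_Sets"
begin

text \<open>
  A finite simple graph is a \<^locale>\<open>pair_graph\<close>: an undirected edge \<open>{u, v}\<close> is
  represented by the two arcs \<open>(u, v)\<close> and \<open>(v, u)\<close>, which are its two traversals.
\<close>

definition edge_of :: "'a \<times> 'a \<Rightarrow> 'a set" where
  "edge_of a = {fst a, snd a}"

definition edges :: "'a pair_pre_digraph \<Rightarrow> 'a set set" where
  "edges G = edge_of ` parcs G"

definition graph_dist :: "'a pair_pre_digraph \<Rightarrow> 'a \<Rightarrow> 'a \<Rightarrow> ereal" where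
  "graph_dist G = wf_digraph.\<mu> (with_proj G) (\<lambda>_. 1)"

text \<open>The bound on the length excludes the closed walks \<open>u, v, u\<close>, which are cycles of the
  symmetric digraph but not of the undirected graph.\<close>

definition graph_cycle :: "'a pair_pre_digraph \<Rightarrow> ('a \<times> 'a) list \<Rightarrow> bool" where
  "graph_cycle G p \<longleftrightarrow> pre_digraph.cycle (with_proj G) p \<and> 3 \<le> length p"

text \<open>\<open>D\<close> is the set of forward arcs.\<close>

definition orientation :: "'a pair_pre_digraph \<Rightarrow> ('a \<times> 'a) set \<Rightarrow> bool" where
  "orientation G D \<longleftrightarrow>
     D \<subseteq> parcs G \<and> (\<forall>u v. (u, v) \<in> parcs G \<longrightarrow> ((u, v) \<in> D \<longleftrightarrow> (v, u) \<notin> D))"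

text \<open>Classes, cycles and coordinates are numbered from 0.\<close>

definition oriented_partition ::
  "'a pair_pre_digraph \<Rightarrow> nat \<Rightarrow> (nat \<Rightarrow> 'a set set) \<Rightarrow> ('a \<times> 'a) set \<Rightarrow> bool" where
  "oriented_partition G t F D \<longleftrightarrow>
     partition_on (edges G) (F ` {..<t}) \<and> inj_on F {..<t} \<and> orientation G D"

definition all_singleton :: "nat \<Rightarrow> (nat \<Rightarrow> 'a set set) \<Rightarrow> bool" where
  "all_singleton t F \<longleftrightarrow> (\<forall>j<t. is_singleton (F j))"

definition edge_class :: "nat \<Rightarrow> (nat \<Rightarrow> 'a set set) \<Rightarrow> 'a \<times> 'a \<Rightarrow> nat" where
  "edge_class t F a = (THE j. j < t \<and> edge_of a \<in> F j)"

definition signed_crossings ::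
  "('a \<times> 'a) set \<Rightarrow> 'a set set \<Rightarrow> ('a \<times> 'a) list \<Rightarrow> int" where
  "signed_crossings D X p =
     (\<Sum>a\<leftarrow>p. if edge_of a \<in> X then (if a \<in> D then 1 else - 1) else 0)"

text \<open>The group of all integer vectors indexed by \<open>I\<close>; its elements are extensional functions.\<close>

definition int_power :: "'i set \<Rightarrow> ('i \<Rightarrow> int) monoid" where
  "int_power I = product_group I (\<lambda>_. integer_group)"

definition incidence_vector ::
  "'a pair_pre_digraph \<Rightarrow> ('a \<times> 'a) set \<Rightarrow> ('a \<times> 'a) list \<Rightarrow> 'a set \<Rightarrow> int" where
  "incidence_vector G D p = (\<lambda>e\<in>edges G. signed_crossings D {e} p)"

definition boundary ::
  "'a pair_pre_digraph \<Rightarrow> ('a \<times> 'a) set \<Rightarrow> ('a set \<Rightarrow> int) \<Rightarrow> 'a \<Rightarrow> int" where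
  "boundary G D x =
     (\<lambda>w\<in>pverts G. \<Sum>(u, v)\<in>D. x (edge_of (u, v)) * (of_bool (w = v) - of_bool (w = u)))"

definition cycle_lattice ::
  "'a pair_pre_digraph \<Rightarrow> ('a \<times> 'a) set \<Rightarrow> ('a set \<Rightarrow> int) set" where
  "cycle_lattice G D = kernel (int_power (edges G)) (int_power (pverts G)) (boundary G D)"

text \<open>Bijectivity of the map from coefficient vectors to linear combinations says that every
  element of the cycle lattice has a unique expansion, and that every integer combination
  (in particular, every incidence vector) lies in the cycle lattice.\<close>

definition integral_cycle_basis ::
  "'a pair_pre_digraph \<Rightarrow> ('a \<times> 'a) set \<Rightarrow> nat \<Rightarrow> (nat \<Rightarrow> ('a \<times> 'a) list) \<Rightarrow> bool" where
  "integral_cycle_basis G D c B \<longleftrightarrow>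
     (\<forall>i<c. graph_cycle G (B i)) \<and>
     bij_betw (\<lambda>k. \<lambda>e\<in>edges G. \<Sum>i<c. k i * incidence_vector G D (B i) e)
       (carrier (int_power {..<c})) (cycle_lattice G D)"

definition cycle_class_matrix ::
  "('a \<times> 'a) set \<Rightarrow> (nat \<Rightarrow> 'a set set) \<Rightarrow> (nat \<Rightarrow> ('a \<times> 'a) list) \<Rightarrow> nat \<Rightarrow> nat \<Rightarrow> int" where
  "cycle_class_matrix D F B i j = signed_crossings D (F j) (B i)"

definition row_lattice :: "nat \<Rightarrow> nat \<Rightarrow> (nat \<Rightarrow> nat \<Rightarrow> int) \<Rightarrow> (nat \<Rightarrow> int) set" where
  "row_lattice c t A = generate (int_power {..<t}) ((\<lambda>i. \<lambda>j\<in>{..<t}. A i j) ` {..<c})"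

definition univ_group :: "nat \<Rightarrow> nat \<Rightarrow> (nat \<Rightarrow> nat \<Rightarrow> int) \<Rightarrow> (nat \<Rightarrow> int) set monoid" where
  "univ_group c t A = int_power {..<t} Mod row_lattice c t A"

definition univ_gen :: "nat \<Rightarrow> nat \<Rightarrow> (nat \<Rightarrow> nat \<Rightarrow> int) \<Rightarrow> nat \<Rightarrow> (nat \<Rightarrow> int) set" where
  "univ_gen c t A j =
     row_lattice c t A #>\<^bsub>int_power {..<t}\<^esub> (\<lambda>k\<in>{..<t}. of_bool (k = j))"

text \<open>Abelian groups are written multiplicatively from here on, as in the library: \<open>\<otimes>\<close>,
  \<open>inv\<close> and \<open>\<one>\<close> are the sum, the negative and zero.\<close>

definition path_label ::
  "('a \<times> 'a) set \<Rightarrow> nat \<Rightarrow> (nat \<Rightarrow> 'a set set) \<Rightarrow> ('g, 'm) monoid_scheme \<Rightarrow> (nat \<Rightarrow> 'g)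
     \<Rightarrow> ('a \<times> 'a) list \<Rightarrow> 'g" where
  "path_label D t F \<Gamma> g p =
     foldr (\<lambda>a x. (if a \<in> D then g (edge_class t F a) else inv\<^bsub>\<Gamma>\<^esub> g (edge_class t F a)) \<otimes>\<^bsub>\<Gamma>\<^esub> x)
       p \<one>\<^bsub>\<Gamma>\<^esub>"

text \<open>The label of \<open>v\<close> is the common label of all paths from the root \<open>r\<close> to \<open>v\<close>.\<close>

definition quotient_labeling ::
  "'a pair_pre_digraph \<Rightarrow> ('a \<times> 'a) set \<Rightarrow> nat \<Rightarrow> (nat \<Rightarrow> 'a set set)
     \<Rightarrow> ('g, 'm) monoid_scheme \<Rightarrow> (nat \<Rightarrow> 'g) \<Rightarrow> 'a \<Rightarrow> 'a \<Rightarrow> 'g" where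
  "quotient_labeling G D t F \<Gamma> g r v =
     (THE x. \<forall>p. pre_digraph.apath (with_proj G) r p v \<longrightarrow> path_label D t F \<Gamma> g p = x)"

definition nonzero_gens :: "nat \<Rightarrow> ('g, 'm) monoid_scheme \<Rightarrow> (nat \<Rightarrow> 'g) \<Rightarrow> 'g set" where
  "nonzero_gens t \<Gamma> g = g ` {..<t} - {\<one>\<^bsub>\<Gamma>\<^esub>}"

text \<open>\<open>cayley \<Gamma> S\<close> has the connection set \<open>S \<union> -S\<close>.\<close>

definition cayley :: "('g, 'm) monoid_scheme \<Rightarrow> 'g set \<Rightarrow> 'g pair_pre_digraph" where
  "cayley \<Gamma> S =
     \<lparr> pverts = carrier \<Gamma>,
       parcs = {(h, h \<otimes>\<^bsub>\<Gamma>\<^esub> s) | h s. h \<in> carrier \<Gamma> \<and> s \<in> S \<union> m_inv \<Gamma> ` S} \<rparr>"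

end

theory Submission
  imports Defs
begin

text \<open>
  For the all-singleton partition the row lattice is the whole cycle lattice, that is, the set of
  integer chains killed by every coboundary. Hence every \<open>f : V \<rightarrow> \<int>\<close> induces a homomorphism
  \<open>L\<^sub>f\<close> from the universal group to \<open>\<int>\<close> with \<open>L\<^sub>f (\<phi> v) = f v - f r\<close>, and these homomorphisms
  separate points. Adjacent vertices therefore have labels that differ by a generator, so \<open>\<phi>\<close> does
  not increase distances. It does not decrease them either: for \<open>f = d\<^sub>G(u, _)\<close> the homomorphism
  \<open>L\<^sub>f\<close> is bounded by \<open>1\<close> on the generators, and it increases by \<open>d\<^sub>G(u, v)\<close> from \<open>\<phi> u\<close> to
  \<open>\<phi> v\<close>.
\<close>

section \<open>Distances in Cayley graphs\<close>

lemma graph_dist_eq_INF: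
  assumes "pair_wf_digraph G"
  shows "graph_dist G u v = (INF p\<in>{p. pre_digraph.awalk (with_proj G) u p v}. ereal (real (length p)))"
proof -
  interpret pair_wf_digraph G by fact
  have "awalk_cost (\<lambda>_. 1) p = real (length p)" for p
    by (induction p) auto
  then show ?thesis
    by (simp add: graph_dist_def \<mu>_def)
qed

lemma graph_dist_le_length:
  assumes "pair_wf_digraph G" "pre_digraph.awalk (with_proj G) u p v"
  shows "graph_dist G u v \<le> ereal (real (length p))"
  using assms by (auto simp: graph_dist_eq_INF intro: INF_lower2)

lemma awalk_map_arcs:
  assumes "pair_wf_digraph G" "pair_wf_digraph H"
    and "\<And>w. w \<in> pverts G \<Longrightarrow> h w \<in> pverts H"
    and "\<And>a b. (a, b) \<in> parcs G \<Longrightarrow> (h a, h b) \<in> parcs H"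
    and "pre_digraph.awalk (with_proj G) u p v"
  shows "pre_digraph.awalk (with_proj H) (h u) (map (map_prod h h) p) (h v)"
proof -
  interpret G: pair_wf_digraph G by fact
  interpret H: pair_wf_digraph H by fact
  show ?thesis
    using assms(5) by (induction p arbitrary: u) (auto simp: G.awalk_simps H.awalk_simps assms(3,4))
qed

text \<open>An arc-preserving map, injective or not, sends each walk to a walk of the same length.
  If \<open>G\<close> has no walk from \<open>u\<close> to \<open>v\<close>, the right-hand side is
  infinite.\<close>

lemma graph_dist_hom_le:
  assumes "pair_wf_digraph G" "pair_wf_digraph H"
    and "\<And>w. w \<in> pverts G \<Longrightarrow> h w \<in> pverts H"
    and "\<And>a b. (a, b) \<in> parcs G \<Longrightarrow> (h a, h b) \<in> parcs H"
  shows "graph_dist H (h u) (h v) \<le> graph_dist G u v"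
  unfolding graph_dist_eq_INF[OF assms(1)]
proof (rule INF_greatest)
  fix p assume "p \<in> {p. pre_digraph.awalk (with_proj G) u p v}"
  then have "pre_digraph.awalk (with_proj H) (h u) (map (map_prod h h) p) (h v)"
    using awalk_map_arcs[of G H h u p v] assms by blast
  from graph_dist_le_length[OF assms(2) this]
  show "graph_dist H (h u) (h v) \<le> ereal (real (length p))"
    by simp
qed

lemma wf_cayley:
  assumes "group \<Gamma>" "S \<subseteq> carrier \<Gamma>"
  shows "pair_wf_digraph (cayley \<Gamma> S)"
proof -
  interpret group \<Gamma> by fact
  show ?thesis
    using assms(2) by unfold_locales (auto simp: cayley_def)
qed

lemma graph_dist_cayley_hom_le:
  assumes "group \<Gamma>" "group H" "\<psi> \<in> hom \<Gamma> H" "S \<subseteq> carrier \<Gamma>"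
  shows "graph_dist (cayley H (\<psi> ` S)) (\<psi> x) (\<psi> y) \<le> graph_dist (cayley \<Gamma> S) x y"
proof -
  interpret group_hom \<Gamma> H \<psi>
    using assms by (simp add: group_hom_def group_hom_axioms_def)
  have "\<psi> ` S \<subseteq> carrier H"
    using assms(4) by auto
  then have wfs: "pair_wf_digraph (cayley \<Gamma> S)" "pair_wf_digraph (cayley H (\<psi> ` S))"
    using assms wf_cayley by blast+
  show ?thesis
  proof (rule graph_dist_hom_le[OF wfs])
    fix a b assume "(a, b) \<in> parcs (cayley \<Gamma> S)"
    then obtain s where s: "a \<in> carrier \<Gamma>" "s \<in> S \<union> m_inv \<Gamma> ` S" "b = a \<otimes>\<^bsub>\<Gamma>\<^esub> s"
      by (auto simp: cayley_def)
    then have "\<psi> s \<in> \<psi> ` S \<union> m_inv H ` \<psi> ` S" "s \<in> carrier \<Gamma>"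
      using assms(4) by (force simp: image_iff)+
    with s show "(\<psi> a, \<psi> b) \<in> parcs (cayley H (\<psi> ` S))"
      by (auto simp: cayley_def)
  qed (auto simp: cayley_def)
qed

text \<open>Homomorphisms do not increase Cayley distances when the connection set is mapped along;
  apply this to \<open>\<psi>\<close> and to its inverse.\<close>

lemma graph_dist_cayley_iso:
  assumes "group \<Gamma>" "group H" "\<psi> \<in> iso \<Gamma> H" "S \<subseteq> carrier \<Gamma>"
    and "x \<in> carrier \<Gamma>" "y \<in> carrier \<Gamma>"
  shows "graph_dist (cayley H (\<psi> ` S)) (\<psi> x) (\<psi> y) = graph_dist (cayley \<Gamma> S) x y"
proof (rule antisym)
  let ?\<theta> = "inv_into (carrier \<Gamma>) \<psi>"
  have inj: "inj_on \<psi> (carrier \<Gamma>)" and hom: "\<psi> \<in> hom \<Gamma> H"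
    using assms(3) by (auto simp: iso_def bij_betw_def)
  show "graph_dist (cayley H (\<psi> ` S)) (\<psi> x) (\<psi> y) \<le> graph_dist (cayley \<Gamma> S) x y"
    using assms hom by (intro graph_dist_cayley_hom_le)
  have "?\<theta> \<in> hom H \<Gamma>"
    using group.iso_set_sym[OF assms(1,3)] by (simp add: iso_def)
  moreover have "\<psi> ` S \<subseteq> carrier H"
    using assms(4) hom by (auto simp: hom_def)
  ultimately have "graph_dist (cayley \<Gamma> (?\<theta> ` \<psi> ` S)) (?\<theta> (\<psi> x)) (?\<theta> (\<psi> y))
      \<le> graph_dist (cayley H (\<psi> ` S)) (\<psi> x) (\<psi> y)"
    using assms by (intro graph_dist_cayley_hom_le)
  moreover have "?\<theta> ` \<psi> ` S = S"
    using inj assms(4) by (simp add: inv_into_image_cancel)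
  ultimately show "graph_dist (cayley \<Gamma> S) x y \<le> graph_dist (cayley H (\<psi> ` S)) (\<psi> x) (\<psi> y)"
    using inj assms by simp
qed

text \<open>Each arc multiplies by some \<open>s\<close> or its inverse, so \<open>L\<close> changes
  by at most 1 per arc, and the changes add up along the walk.\<close>

lemma cayley_walk_displacement:
  assumes "group \<Gamma>" "S \<subseteq> carrier \<Gamma>" "L \<in> hom \<Gamma> integer_group"
    and "\<And>s. s \<in> S \<Longrightarrow> \<bar>L s\<bar> \<le> 1"
    and "pre_digraph.awalk (with_proj (cayley \<Gamma> S)) x p y"
  shows "\<bar>L y - L x\<bar> \<le> int (length p)"
proof -
  interpret group_hom \<Gamma> integer_group L
    using assms by (simp add: group_hom_def group_hom_axioms_def)
  interpret C: pair_wf_digraph "cayley \<Gamma> S"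
    using assms wf_cayley by blast
  have step: "\<bar>L b - L a\<bar> \<le> 1" if ab: "(a, b) \<in> parcs (cayley \<Gamma> S)" for a b
  proof -
    obtain s where s: "a \<in> carrier \<Gamma>" "s \<in> S \<union> m_inv \<Gamma> ` S" "b = a \<otimes>\<^bsub>\<Gamma>\<^esub> s"
      using ab by (auto simp: cayley_def)
    then have "\<bar>L s\<bar> \<le> 1" "s \<in> carrier \<Gamma>"
      using assms(2,4) by (auto simp: subset_iff)
    with s show ?thesis by simp
  qed
  show ?thesis
    using assms(5)
  proof (induction p arbitrary: x)
    case Nil
    then show ?case by (simp add: C.awalk_simps)
  next
    case (Cons a p)
    then have "\<bar>L y - L (snd a)\<bar> \<le> int (length p)" "\<bar>L (snd a) - L x\<bar> \<le> 1"
      using step[of "fst a" "snd a"] by (auto simp: C.awalk_simps)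
    then show ?case by simp
  qed
qed

text \<open>The function is the distance from \<open>u\<close>, rebuilt with integer values because
  \<open>graph_dist\<close> is an extended real.\<close>

lemma graph_dist_eq_lipschitz_function:
  assumes "pair_sym_digraph G" "u \<in> pverts G" "\<And>w. w \<in> pverts G \<Longrightarrow> \<exists>p. pre_digraph.awalk (with_proj G) u p w"
  obtains f :: "'a \<Rightarrow> int" where
    "\<And>a b. (a, b) \<in> parcs G \<Longrightarrow> \<bar>f b - f a\<bar> \<le> 1" "f u = 0"
    "\<And>w. w \<in> pverts G \<Longrightarrow> graph_dist G u w \<le> ereal (real_of_int (f w))"
proof -
  interpret pair_sym_digraph G by fact
  \<comment> \<open>The minimum is attained at every vertex, since all of them are reachable from
    \<open>u\<close>.\<close>
  define d where "d w = (LEAST k. \<exists>p. awalk u p w \<and> length p = k)" for w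
  have d_walk: "\<exists>p. awalk u p w \<and> length p = d w" if "w \<in> pverts G" for w
    unfolding d_def by (rule LeastI_ex) (use assms(3)[OF that] in blast)
  have d_le: "d w \<le> length p" if "awalk u p w" for p w
    unfolding d_def by (rule Least_le) (use that in blast)
  have step: "d b \<le> Suc (d a)" if ab: "(a, b) \<in> parcs G" for a b
  proof -
    obtain p where p: "awalk u p a" "length p = d a"
      using d_walk in_arcsD1[OF ab] by blast
    from p(1) have "awalk u (p @ [(a, b)]) b"
      using ab in_arcsD2[OF ab] by (intro awalk_appendI[of u p a]) (simp_all add: awalk_simps)
    from d_le[OF this] p show ?thesis by simp
  qed
  show ?thesis
  proof
    fix a b assume "(a, b) \<in> parcs G"
    \<comment> \<open>Appending an arc bounds the increase only; the reversed arc bounds the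
      decrease.\<close>
    then show "\<bar>int (d b) - int (d a)\<bar> \<le> 1"
      using step[of a b] step[of b a] arcs_symmetric by fastforce
  next
    show "int (d u) = 0"
      using d_le[of "[]" u] assms(2) by (simp add: awalk_simps)
  next
    fix w assume "w \<in> pverts G"
    then obtain p where "awalk u p w" "length p = d w"
      using d_walk by blast
    then show "graph_dist G u w \<le> ereal (real_of_int (int (d w)))"
      using graph_dist_le_length[OF pair_wf_digraph_axioms] by fastforce
  qed
qed

text \<open>A criterion for isometry: \<open>step\<close> makes \<open>\<phi>\<close> map arcs to
  arcs and gives the upper bound, while \<open>functional\<close> turns the distance from
  \<open>u\<close> into a homomorphism that certifies the lower bound.\<close>

lemma graph_dist_cayley_embedding:
  fixes \<phi> :: "'a \<Rightarrow> 'g" and \<Gamma> :: "('g, 'm) monoid_scheme"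
  assumes "pair_sym_digraph G" "group \<Gamma>" "S \<subseteq> carrier \<Gamma>"
    and conn: "\<And>u w. u \<in> pverts G \<Longrightarrow> w \<in> pverts G \<Longrightarrow> \<exists>p. pre_digraph.awalk (with_proj G) u p w"
    and \<phi>: "\<And>w. w \<in> pverts G \<Longrightarrow> \<phi> w \<in> carrier \<Gamma>"
    and step: "\<And>a b. (a, b) \<in> parcs G \<Longrightarrow> \<exists>s\<in>S \<union> m_inv \<Gamma> ` S. \<phi> b = \<phi> a \<otimes>\<^bsub>\<Gamma>\<^esub> s"
    and functional: "\<And>f :: 'a \<Rightarrow> int. (\<And>a b. (a, b) \<in> parcs G \<Longrightarrow> \<bar>f b - f a\<bar> \<le> 1) \<Longrightarrow>
      \<exists>L\<in>hom \<Gamma> integer_group. (\<forall>s\<in>S. \<bar>L s\<bar> \<le> 1) \<and>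
        (\<forall>a\<in>pverts G. \<forall>b\<in>pverts G. L (\<phi> b) - L (\<phi> a) = f b - f a)"
    and uv: "u \<in> pverts G" "v \<in> pverts G"
  shows "graph_dist (cayley \<Gamma> S) (\<phi> u) (\<phi> v) = graph_dist G u v"
proof (rule antisym)
  interpret pair_sym_digraph G by fact
  have wf: "pair_wf_digraph (cayley \<Gamma> S)"
    using assms(2,3) by (rule wf_cayley)
  show "graph_dist (cayley \<Gamma> S) (\<phi> u) (\<phi> v) \<le> graph_dist G u v"
    using \<phi> step in_arcsD1
    by (intro graph_dist_hom_le[OF pair_wf_digraph_axioms wf]) (fastforce simp: cayley_def)+
  obtain f :: "'a \<Rightarrow> int" where f: "\<And>a b. (a, b) \<in> parcs G \<Longrightarrow> \<bar>f b - f a\<bar> \<le> 1" "f u = 0"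
    "graph_dist G u v \<le> ereal (real_of_int (f v))"
    using graph_dist_eq_lipschitz_function[OF assms(1) uv(1) conn[OF uv(1)]] uv by metis
  obtain L where L: "L \<in> hom \<Gamma> integer_group" "\<And>s. s \<in> S \<Longrightarrow> \<bar>L s\<bar> \<le> 1"
    "L (\<phi> v) - L (\<phi> u) = f v - f u"
    using functional[of f] f(1) uv by metis
  show "graph_dist G u v \<le> graph_dist (cayley \<Gamma> S) (\<phi> u) (\<phi> v)"
    unfolding graph_dist_eq_INF[OF wf]
  proof (rule INF_greatest)
    fix p assume "p \<in> {p. pre_digraph.awalk (with_proj (cayley \<Gamma> S)) (\<phi> u) p (\<phi> v)}"
    \<comment> \<open>Along \<open>p\<close> the value of \<open>L\<close> changes by
      \<open>f v - f u\<close>, which is \<open>f v\<close>, and by at most 1 per arc.\<close>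
    then have "f v \<le> int (length p)"
      using cayley_walk_displacement[OF assms(2,3) L(1,2), of "\<phi> u" p "\<phi> v"] L(3) f(2) by auto
    then have "ereal (real_of_int (f v)) \<le> ereal (real (length p))"
      by simp
    with f(3) show "graph_dist G u v \<le> ereal (real (length p))"
      by (rule order_trans)
  qed
qed

section \<open>Integer vectors\<close>

lemma carrier_int_power: "carrier (int_power I) = extensional I"
  by (simp add: int_power_def PiE_def)

lemma mult_int_power: "x \<otimes>\<^bsub>int_power I\<^esub> y = (\<lambda>i\<in>I. x i + y i)"
  by (simp add: int_power_def)

lemma one_int_power: "\<one>\<^bsub>int_power I\<^esub> = (\<lambda>i\<in>I. 0)"
  by (simp add: int_power_def)

lemma group_int_power: "group (int_power I)"
  by (simp add: int_power_def)

lemma comm_group_int_power: "comm_group (int_power I)"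
  by (rule group.group_comm_groupI[OF group_int_power])
    (simp add: mult_int_power add.commute)

lemma inv_int_power: "x \<in> extensional I \<Longrightarrow> inv\<^bsub>int_power I\<^esub> x = (\<lambda>i\<in>I. - x i)"
  unfolding int_power_def by (subst inv_product_group) (auto simp: PiE_def)

lemma hom_sum_coordinates:
  "(\<lambda>x. \<Sum>i\<in>I. x i * w i) \<in> hom (int_power I) integer_group"
  by (rule homI) (simp_all add: mult_int_power ring_distribs sum.distrib)

text \<open>Repeated addition gives the nonnegative multiples, and inverses give the negative
  ones.\<close>

lemma subgroup_int_power_scale:
  fixes k :: int
  assumes H: "subgroup H (int_power I)" and x: "x \<in> H"
  shows "(\<lambda>i\<in>I. k * x i) \<in> H"
proof -
  interpret subgroup H "int_power I" by fact
  have nat_scale: "(\<lambda>i\<in>I. int m * x i) \<in> H" for m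
  proof (induction m)
    case 0
    then show ?case using one_closed by (simp add: one_int_power restrict_def)
  next
    case (Suc m)
    from m_closed[OF x this] show ?case
      by (simp add: mult_int_power ring_distribs restrict_def cong: if_cong)
  qed
  show ?thesis
  proof (cases "k \<ge> 0")
    case True
    then show ?thesis using nat_scale[of "nat k"] by simp
  next
    case False
    have "(\<lambda>i\<in>I. - (\<lambda>i\<in>I. int (nat (- k)) * x i) i) \<in> H"
      using m_inv_closed[OF nat_scale[of "nat (- k)"]] by (simp add: inv_int_power)
    with False show ?thesis by (simp cong: restrict_cong)
  qed
qed

lemma subgroup_int_power_combination:
  fixes k :: "nat \<Rightarrow> int"
  assumes H: "subgroup H (int_power I)" and x: "\<And>i. i < c \<Longrightarrow> (\<lambda>j\<in>I. x i j) \<in> H"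
  shows "(\<lambda>j\<in>I. \<Sum>i<c. k i * x i j) \<in> H"
  using x
proof (induction c)
  case 0
  then show ?case using subgroup.one_closed[OF H] by (simp add: one_int_power restrict_def)
next
  case (Suc c)
  have "(\<lambda>j\<in>I. k c * x c j) \<in> H"
    using subgroup_int_power_scale[OF H Suc.prems[OF lessI], of "k c"] by (simp cong: restrict_cong)
  from subgroup.m_closed[OF H Suc.IH[OF Suc.prems] this] show ?case
    by (simp add: mult_int_power restrict_def cong: if_cong)
qed

section \<open>The universal group of the all-singleton partition\<close>

text \<open>The enumeration \<open>\<alpha>\<close> lists the forward arcs so that class
  \<open>j\<close> consists of the edge of \<open>\<alpha> j\<close> alone. Vectors indexed by
  classes are thereby the same as integer chains on the edges.\<close>

locale singleton_partition = pair_graph G for G :: "'a pair_pre_digraph" +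
  fixes D :: "('a \<times> 'a) set" and \<alpha> :: "nat \<Rightarrow> 'a \<times> 'a" and t :: nat and F :: "nat \<Rightarrow> 'a set set"
    and c :: nat and B :: "nat \<Rightarrow> ('a \<times> 'a) list" and r :: 'a
  assumes connected: "connected (with_proj G)"
    and orientation: "orientation G D"
    and \<alpha>_bij: "bij_betw \<alpha> {..<t} D"
    and F_eq: "\<And>j. j < t \<Longrightarrow> F j = {edge_of (\<alpha> j)}"
    and basis: "integral_cycle_basis G D c B"
    and root: "r \<in> pverts G"
begin

abbreviation "A \<equiv> cycle_class_matrix D F B"
abbreviation "N \<equiv> row_lattice c t A"
abbreviation "\<Gamma> \<equiv> univ_group c t A"
abbreviation "g \<equiv> univ_gen c t A"
abbreviation "\<phi> \<equiv> quotient_labeling G D t F \<Gamma> g r"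
abbreviation "S \<equiv> nonzero_gens t \<Gamma> g"
abbreviation "Zt \<equiv> int_power {..<t}"

text \<open>The value of the coboundary of \<open>f\<close> on the integer chain \<open>x\<close>.\<close>

definition pairing :: "('a \<Rightarrow> int) \<Rightarrow> (nat \<Rightarrow> int) \<Rightarrow> int" where
  "pairing f x = (\<Sum>j<t. x j * (f (snd (\<alpha> j)) - f (fst (\<alpha> j))))"

section \<open>Numbering the edges by their forward arcs\<close>

lemma D_subset: "D \<subseteq> parcs G"
  and D_iff: "(u, v) \<in> parcs G \<Longrightarrow> (u, v) \<in> D \<longleftrightarrow> (v, u) \<notin> D"
  using orientation by (auto simp: orientation_def)

lemma \<alpha>_in_D: "j < t \<Longrightarrow> \<alpha> j \<in> D"
  using \<alpha>_bij by (auto simp: bij_betw_def)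

text \<open>Only one of the two traversals of an edge is forward.\<close>

lemma edge_of_inj_on_D: "inj_on edge_of D"
proof (rule inj_onI)
  fix a b assume ab: "a \<in> D" "b \<in> D" "edge_of a = edge_of b"
  obtain u v w z where [simp]: "a = (u, v)" "b = (w, z)"
    by (metis prod.collapse)
  have "(u, v) \<in> parcs G" "(v, u) \<notin> D"
    using ab(1) D_subset D_iff[of u v] by auto
  then show "a = b"
    using ab by (auto simp: edge_of_def doubleton_eq_iff)
qed

lemma edge_of_D: "edge_of ` D = edges G"
proof -
  have "edge_of a \<in> edge_of ` D" if "a \<in> parcs G" for a
  proof (cases "a \<in> D")
    case False
    then have "(snd a, fst a) \<in> D"
      using that D_iff[of "fst a" "snd a"] by simp
    moreover have "edge_of a = edge_of (snd a, fst a)"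
      by (auto simp: edge_of_def)
    ultimately show ?thesis by blast
  qed simp
  then show ?thesis
    using D_subset by (auto simp: edges_def)
qed

lemma edge_of_\<alpha>_bij: "bij_betw (\<lambda>j. edge_of (\<alpha> j)) {..<t} (edges G)"
  using bij_betw_trans[OF \<alpha>_bij, of edge_of "edges G"] edge_of_inj_on_D edge_of_D
  by (simp add: bij_betw_def o_def)

lemma edge_class_eq:
  assumes "j < t" "edge_of a = edge_of (\<alpha> j)"
  shows "edge_class t F a = j"
  unfolding edge_class_def
proof (rule the_equality)
  show "j < t \<and> edge_of a \<in> F j"
    using assms by (simp add: F_eq)
  fix i assume i: "i < t \<and> edge_of a \<in> F i"
  then have "edge_of (\<alpha> i) = edge_of (\<alpha> j)"
    using assms(2) F_eq[of i] by simp
  then show "i = j"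
    using assms(1) i inj_onD[OF bij_betw_imp_inj_on[OF edge_of_\<alpha>_bij]] by blast
qed

lemma edge_class_arc:
  assumes "a \<in> parcs G"
  shows "edge_class t F a < t"
    and "\<alpha> (edge_class t F a) = (if a \<in> D then a else (snd a, fst a))"
proof -
  let ?a = "if a \<in> D then a else (snd a, fst a)"
  have "?a \<in> D"
    using assms D_iff[of "fst a" "snd a"] by simp
  then obtain j where j: "j < t" "\<alpha> j = ?a"
    using \<alpha>_bij by (auto simp: bij_betw_def)
  moreover have "edge_of a = edge_of (\<alpha> j)"
    unfolding j(2) by (auto simp: edge_of_def)
  ultimately show "edge_class t F a < t" "\<alpha> (edge_class t F a) = ?a"
    using edge_class_eq by auto
qed

lemma awalk_exists:
  assumes "u \<in> pverts G" "v \<in> pverts G"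
  shows "\<exists>p. awalk u p v"
proof -
  have "strongly_connected (with_proj G)"
    using symmetric_connected_imp_strongly_connected[OF sym_arcs connected] .
  then show ?thesis
    using assms by (auto simp: strongly_connected_def simp flip: reachable_awalk)
qed

section \<open>Pairing chains with coboundaries\<close>

lemma pairing_hom: "pairing f \<in> hom Zt integer_group"
  using hom_sum_coordinates unfolding pairing_def .

lemma pairing_restrict: "pairing f (\<lambda>j\<in>{..<t}. x j) = pairing f x"
  by (simp add: pairing_def)

lemma pairing_sum_scale: "pairing f (\<lambda>j. \<Sum>i\<in>I. k i * x i j) = (\<Sum>i\<in>I. k i * pairing f (x i))"
  unfolding pairing_def sum_distrib_right sum_distrib_left
  by (subst sum.swap) (simp add: mult.assoc)

lemma pairing_unit: "j < t \<Longrightarrow> pairing f (\<lambda>k. of_bool (k = j)) = f (snd (\<alpha> j)) - f (fst (\<alpha> j))"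
  unfolding pairing_def of_bool_def
  by (simp add: if_distrib[of "\<lambda>x. x * _"] sum.delta cong: if_cong)

text \<open>On the vertices \<open>f\<close> is a combination of vertex indicators, and the pairing
  is linear in \<open>f\<close>. So a chain killed by the coboundaries of all indicators is killed
  by every coboundary.\<close>

lemma pairing_expand:
  "pairing f x = (\<Sum>w\<in>pverts G. f w * pairing (\<lambda>v. of_bool (v = w)) x)"
proof -
  have point: "(\<Sum>w\<in>pverts G. f w * of_bool (v = w)) = f v" if "v \<in> pverts G" for v
    using that pair_finite_verts by (simp add: of_bool_def if_distrib sum.delta cong: if_cong)
  have *: "f (snd (\<alpha> j)) - f (fst (\<alpha> j)) =
      (\<Sum>w\<in>pverts G. f w * (of_bool (snd (\<alpha> j) = w) - of_bool (fst (\<alpha> j) = w)))" if "j < t" for j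
    using that \<alpha>_in_D[OF that] D_subset arc_fst_in_verts arc_snd_in_verts
    by (auto simp: right_diff_distrib sum_subtractf point)
  have "pairing f x = (\<Sum>j<t. \<Sum>w\<in>pverts G. x j *
      (f w * (of_bool (snd (\<alpha> j) = w) - of_bool (fst (\<alpha> j) = w))))"
    by (simp add: pairing_def * sum_distrib_left)
  also have "\<dots> = (\<Sum>w\<in>pverts G. \<Sum>j<t. f w *
      (x j * (of_bool (snd (\<alpha> j) = w) - of_bool (fst (\<alpha> j) = w))))"
    by (subst sum.swap) (simp add: algebra_simps)
  also have "\<dots> = (\<Sum>w\<in>pverts G. f w * pairing (\<lambda>v. of_bool (v = w)) x)"
    by (simp add: pairing_def sum_distrib_left)
  finally show ?thesis .
qed

text \<open>Boundary and coboundary are adjoint: a coordinate of the boundary is the pairing with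
  the coboundary of a vertex indicator.\<close>

lemma boundary_eq_pairing:
  assumes "w \<in> pverts G"
  shows "boundary G D y w = pairing (\<lambda>v. of_bool (v = w)) (\<lambda>j. y (edge_of (\<alpha> j)))"
proof -
  have "boundary G D y w = (\<Sum>a\<in>D. y (edge_of a) * (of_bool (w = snd a) - of_bool (w = fst a)))"
    using assms by (simp add: boundary_def case_prod_unfold)
  also have "\<dots> = pairing (\<lambda>v. of_bool (v = w)) (\<lambda>j. y (edge_of (\<alpha> j)))"
    unfolding pairing_def by (subst sum.reindex_bij_betw[OF \<alpha>_bij, symmetric]) (simp add: eq_commute)
  finally show ?thesis .
qed

text \<open>Testing against every \<open>f\<close>, not just against vertex indicators, later allows
  \<open>f\<close> to be a distance function.\<close>

lemma cycle_lattice_iff: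
  "y \<in> cycle_lattice G D \<longleftrightarrow>
     y \<in> extensional (edges G) \<and> (\<forall>f. pairing f (\<lambda>j. y (edge_of (\<alpha> j))) = 0)"
  (is "_ \<longleftrightarrow> _ \<and> (\<forall>f. ?P f)")
proof -
  have "boundary G D y = (\<lambda>w\<in>pverts G. 0) \<longleftrightarrow> (\<forall>w\<in>pverts G. ?P (\<lambda>v. of_bool (v = w)))"
    by (auto simp: fun_eq_iff boundary_eq_pairing[symmetric]) (auto simp: boundary_def)
  also have "\<dots> \<longleftrightarrow> (\<forall>f. ?P f)"
    by (metis (no_types, lifting) mult_zero_right pairing_expand sum.neutral)
  finally show ?thesis
    by (simp add: cycle_lattice_def kernel_def carrier_int_power one_int_power)
qed

lemma row_eq_incidence_vector:
  "j < t \<Longrightarrow> A i j = incidence_vector G D (B i) (edge_of (\<alpha> j))"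
  using bij_betw_apply[OF edge_of_\<alpha>_bij, of j]
  by (simp add: cycle_class_matrix_def incidence_vector_def F_eq)

lemma combination_in_cycle_lattice:
  "(\<lambda>e\<in>edges G. \<Sum>i<c. k i * incidence_vector G D (B i) e) \<in> cycle_lattice G D"
  if "k \<in> extensional {..<c}"
  using basis that by (auto simp: integral_cycle_basis_def bij_betw_def carrier_int_power)

lemma pairing_row:
  assumes "i < c"
  shows "pairing f (A i) = 0"
proof -
  \<comment> \<open>The basis property speaks of integer combinations only; this unit coefficient
    vector singles out the cycle \<open>B i\<close>.\<close>
  let ?k = "\<lambda>l\<in>{..<c}. of_bool (l = i) :: int"
  have "(\<Sum>l<c. ?k l * incidence_vector G D (B l) e) = incidence_vector G D (B i) e" for e
    using assms by (simp add: of_bool_def if_distrib[of "\<lambda>x. x * _"] sum.delta cong: if_cong)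
  then have "(\<lambda>e\<in>edges G. incidence_vector G D (B i) e) \<in> cycle_lattice G D"
    using combination_in_cycle_lattice[of ?k] by simp
  then have "pairing f (\<lambda>j. (\<lambda>e\<in>edges G. incidence_vector G D (B i) e) (edge_of (\<alpha> j))) = 0"
    by (simp add: cycle_lattice_iff)
  then show ?thesis
    using bij_betw_apply[OF edge_of_\<alpha>_bij] by (simp add: pairing_def row_eq_incidence_vector)
qed

section \<open>The row lattice as the annihilator of the coboundaries\<close>

lemma N_subgroup: "subgroup N Zt"
  unfolding row_lattice_def
  by (rule group.generate_is_subgroup[OF group_int_power]) (auto simp: carrier_int_power)

text \<open>For singleton classes the rows of \<open>A\<close> are the incidence vectors of the
  basis cycles. They lie in the kernel of each pairing, hence so does the lattice they generate;
  conversely, a chain killed by all pairings is a cycle and expands integrally in the basis.\<close>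

lemma N_iff: "x \<in> N \<longleftrightarrow> x \<in> extensional {..<t} \<and> (\<forall>f. pairing f x = 0)"
proof
  assume x: "x \<in> N"
  have "pairing f x = 0" for f
  proof -
    interpret h: group_hom Zt integer_group "pairing f"
      by (simp add: group_hom_def group_hom_axioms_def group_int_power pairing_hom)
    have "(\<lambda>i. \<lambda>j\<in>{..<t}. A i j) ` {..<c} \<subseteq> kernel Zt integer_group (pairing f)"
      by (auto simp: kernel_def carrier_int_power pairing_restrict pairing_row)
    then have "N \<subseteq> kernel Zt integer_group (pairing f)"
      unfolding row_lattice_def
      by (rule group.generate_subgroup_incl[OF group_int_power _ h.subgroup_kernel])
    with x show ?thesis by (auto simp: kernel_def)
  qed
  moreover have "x \<in> extensional {..<t}"
    using x subgroup.subset[OF N_subgroup] by (auto simp: carrier_int_power)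
  ultimately show "x \<in> extensional {..<t} \<and> (\<forall>f. pairing f x = 0)" by blast
next
  assume x: "x \<in> extensional {..<t} \<and> (\<forall>f. pairing f x = 0)"
  \<comment> \<open>This is \<open>x\<close> re-indexed from class numbers to edges.\<close>
  define y where "y = (\<lambda>e\<in>edges G. x (inv_into {..<t} (\<lambda>j. edge_of (\<alpha> j)) e))"
  have y: "y (edge_of (\<alpha> j)) = x j" if "j < t" for j
    using that edge_of_\<alpha>_bij bij_betw_apply[OF edge_of_\<alpha>_bij, of j]
    by (simp add: y_def bij_betw_inv_into_left[OF edge_of_\<alpha>_bij])
  have "pairing f (\<lambda>j. y (edge_of (\<alpha> j))) = pairing f x" for f
    by (simp add: pairing_def y)
  then have "y \<in> cycle_lattice G D"
    using x by (simp add: cycle_lattice_iff y_def)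
  then obtain k where k: "y = (\<lambda>e\<in>edges G. \<Sum>i<c. k i * incidence_vector G D (B i) e)"
    using basis by (auto simp: integral_cycle_basis_def bij_betw_def)
  have "x = (\<lambda>j\<in>{..<t}. \<Sum>i<c. k i * A i j)"
  proof (rule extensionalityI[of _ "{..<t}"])
    fix j assume "j \<in> {..<t}"
    then have j: "j < t" by simp
    have "x j = (\<Sum>i<c. k i * incidence_vector G D (B i) (edge_of (\<alpha> j)))"
      unfolding y[OF j, symmetric] k using bij_betw_apply[OF edge_of_\<alpha>_bij, of j] j by simp
    then show "x j = (\<lambda>j\<in>{..<t}. \<Sum>i<c. k i * A i j) j"
      using j by (simp add: row_eq_incidence_vector)
  qed (use x in auto)
  also have "\<dots> \<in> N"
    by (rule subgroup_int_power_combination[OF N_subgroup])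
      (auto simp: row_lattice_def intro: generate.incl)
  finally show "x \<in> N" .
qed

section \<open>The quotient group and its homomorphisms to the integers\<close>

lemma N_normal: "N \<lhd> Zt"
  by (rule comm_group.subgroup_imp_normal[OF comm_group_int_power N_subgroup])

lemma group_\<Gamma>: "group \<Gamma>"
  unfolding univ_group_def by (rule normal.factorgroup_is_group[OF N_normal])

interpretation \<Gamma>: group \<Gamma>
  by (rule group_\<Gamma>)

lemma carrier_\<Gamma>: "carrier \<Gamma> = (\<lambda>x. N #>\<^bsub>Zt\<^esub> x) ` extensional {..<t}"
  by (simp add: univ_group_def carrier_FactGroup carrier_int_power)

lemma g_in_carrier: "g j \<in> carrier \<Gamma>"
  by (auto simp: carrier_\<Gamma> univ_gen_def)

lemma S_subset: "S \<subseteq> carrier \<Gamma>"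
  using g_in_carrier by (auto simp: nonzero_gens_def)

text \<open>The pairing with \<open>f\<close> vanishes on \<open>N\<close> and so factors through
  the quotient.\<close>

lemma functional_exists:
  "\<exists>L. L \<in> hom \<Gamma> integer_group \<and> (\<forall>x\<in>extensional {..<t}. L (N #>\<^bsub>Zt\<^esub> x) = pairing f x)"
proof -
  interpret h: group_hom Zt integer_group "pairing f"
    by (simp add: group_hom_def group_hom_axioms_def group_int_power pairing_hom)
  have "N \<subseteq> kernel Zt integer_group (pairing f)"
    by (auto simp: kernel_def carrier_int_power N_iff)
  then obtain L where "L \<in> hom (Zt Mod N) integer_group"
    "\<And>x. x \<in> carrier Zt \<Longrightarrow> L (N #>\<^bsub>Zt\<^esub> x) = pairing f x"
    using h.FactGroup_universal_kernel[OF N_normal] by metis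
  then show ?thesis
    by (auto simp: univ_group_def carrier_int_power)
qed

text \<open>This is \<open>L\<^sub>f\<close>. The choice is harmless, since the values on cosets are
  prescribed.\<close>

definition functional :: "('a \<Rightarrow> int) \<Rightarrow> (nat \<Rightarrow> int) set \<Rightarrow> int" where
  "functional f = (SOME L. L \<in> hom \<Gamma> integer_group \<and>
     (\<forall>x\<in>extensional {..<t}. L (N #>\<^bsub>Zt\<^esub> x) = pairing f x))"

lemma functional_hom: "functional f \<in> hom \<Gamma> integer_group"
  and functional_coset: "x \<in> extensional {..<t} \<Longrightarrow> functional f (N #>\<^bsub>Zt\<^esub> x) = pairing f x"
  using someI_ex[OF functional_exists[of f]] unfolding functional_def by auto

lemma functional_group_hom: "group_hom \<Gamma> integer_group (functional f)"
  by (simp add: group_hom_def group_hom_axioms_def group_\<Gamma> functional_hom)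

lemma functional_one: "functional f \<one>\<^bsub>\<Gamma>\<^esub> = 0"
  using group_hom.hom_one[OF functional_group_hom] by simp

lemma functional_mult:
  "X \<in> carrier \<Gamma> \<Longrightarrow> Y \<in> carrier \<Gamma> \<Longrightarrow>
     functional f (X \<otimes>\<^bsub>\<Gamma>\<^esub> Y) = functional f X + functional f Y"
  using hom_mult[OF functional_hom] by simp

lemma functional_inv: "X \<in> carrier \<Gamma> \<Longrightarrow> functional f (inv\<^bsub>\<Gamma>\<^esub> X) = - functional f X"
  using group_hom.hom_inv[OF functional_group_hom] by simp

lemma functional_gen: "j < t \<Longrightarrow> functional f (g j) = f (snd (\<alpha> j)) - f (fst (\<alpha> j))"
  by (simp add: univ_gen_def functional_coset pairing_restrict pairing_unit)

text \<open>A coset on which all functionals vanish has its representative in \<open>N\<close>, by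
  \<open>N_iff\<close>. Equations in \<open>\<Gamma>\<close> can thus be checked by integer
  arithmetic.\<close>

lemma functionals_separate:
  assumes "X \<in> carrier \<Gamma>" "Y \<in> carrier \<Gamma>" "\<And>f. functional f X = functional f Y"
  shows "X = Y"
proof -
  have Z_one: "Z = \<one>\<^bsub>\<Gamma>\<^esub>" if Z: "Z \<in> carrier \<Gamma>" "\<And>f. functional f Z = 0" for Z
  proof -
    obtain z where z: "z \<in> extensional {..<t}" "Z = N #>\<^bsub>Zt\<^esub> z"
      using Z(1) by (auto simp: carrier_\<Gamma>)
    then have "z \<in> N"
      using Z(2) functional_coset by (simp add: N_iff)
    then have "Z = N"
      using z subgroup.rcos_const[OF N_subgroup group_int_power] by simp
    then show ?thesis by (simp add: univ_group_def)
  qed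
  have "X \<otimes>\<^bsub>\<Gamma>\<^esub> inv\<^bsub>\<Gamma>\<^esub> Y = \<one>\<^bsub>\<Gamma>\<^esub>"
    using assms by (intro Z_one) (auto simp: \<Gamma>.m_closed \<Gamma>.inv_closed functional_mult functional_inv)
  then show ?thesis
    using assms(1,2) \<Gamma>.inv_equality[of X "inv\<^bsub>\<Gamma>\<^esub> Y"] by (simp add: \<Gamma>.inv_closed \<Gamma>.inv_inv)
qed

section \<open>Labels of arcs, paths and vertices\<close>

definition arc_label :: "'a \<times> 'a \<Rightarrow> (nat \<Rightarrow> int) set" where
  "arc_label a = (if a \<in> D then g (edge_class t F a) else inv\<^bsub>\<Gamma>\<^esub> g (edge_class t F a))"

lemma arc_label_in_carrier: "arc_label a \<in> carrier \<Gamma>"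
  by (simp add: arc_label_def g_in_carrier \<Gamma>.inv_closed)

lemma functional_arc_label:
  "a \<in> parcs G \<Longrightarrow> functional f (arc_label a) = f (snd a) - f (fst a)"
  using edge_class_arc[of a] by (auto simp: arc_label_def functional_gen functional_inv g_in_carrier)

text \<open>As \<open>S\<close> omits the neutral element, the generator must be shown to be
  nontrivial: the indicator of the head of \<open>\<alpha> ?j\<close> gives it the value 1, because
  there are no loops.\<close>

lemma arc_label_in_S:
  assumes "a \<in> parcs G"
  shows "arc_label a \<in> S \<union> m_inv \<Gamma> ` S"
proof -
  let ?j = "edge_class t F a"
  have "\<alpha> ?j \<in> parcs G"
    using assms edge_class_arc \<alpha>_in_D D_subset by blast
  then have "functional (\<lambda>v. of_bool (v = snd (\<alpha> ?j))) (g ?j) \<noteq> 0"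
    using assms edge_class_arc(1) pair_no_loops by (simp add: functional_gen)
  then have "g ?j \<noteq> \<one>\<^bsub>\<Gamma>\<^esub>"
    by (metis functional_one)
  then have "g ?j \<in> S"
    using assms edge_class_arc(1) by (simp add: nonzero_gens_def)
  then show ?thesis by (simp add: arc_label_def)
qed

text \<open>The differences of \<open>f\<close> along the arcs telescope, so every functional of the
  label depends on the end points only.\<close>

lemma path_label_awalk:
  assumes "awalk u p v"
  shows "path_label D t F \<Gamma> g p \<in> carrier \<Gamma> \<and> functional f (path_label D t F \<Gamma> g p) = f v - f u"
proof -
  have Cons: "path_label D t F \<Gamma> g (a # p) = arc_label a \<otimes>\<^bsub>\<Gamma>\<^esub> path_label D t F \<Gamma> g p" for a p
    by (simp add: path_label_def arc_label_def)
  have Nil: "path_label D t F \<Gamma> g [] = \<one>\<^bsub>\<Gamma>\<^esub>"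
    by (simp add: path_label_def)
  show ?thesis
    using assms
    by (induction p arbitrary: u)
      (auto simp: awalk_simps Cons Nil arc_label_in_carrier functional_arc_label functional_one
        functional_mult \<Gamma>.m_closed \<Gamma>.one_closed)
qed

lemma labeling:
  assumes "v \<in> pverts G"
  shows labeling_in_carrier: "\<phi> v \<in> carrier \<Gamma>"
    and functional_labeling: "functional f (\<phi> v) = f v - f r"
proof -
  obtain p where p: "apath r p v"
    using awalk_exists[OF root assms] apath_awalk_to_apath by blast
  have "\<phi> v = path_label D t F \<Gamma> g p"
    unfolding quotient_labeling_def
  proof (rule the_equality)
    show "\<forall>q. apath r q v \<longrightarrow> path_label D t F \<Gamma> g q = path_label D t F \<Gamma> g p"
    proof (intro allI impI)
      fix q assume "apath r q v"
      then have "awalk r p v" "awalk r q v"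
        using p by (simp_all add: apath_def)
      then show "path_label D t F \<Gamma> g q = path_label D t F \<Gamma> g p"
        \<comment> \<open>Path independence: all functionals agree on the two labels, so the labels
          are equal and the definite description is meaningful.\<close>
        by (intro functionals_separate) (simp_all add: path_label_awalk[of r _ v])
    qed
  qed (use p in simp)
  then show "\<phi> v \<in> carrier \<Gamma>" "functional f (\<phi> v) = f v - f r"
    using path_label_awalk[OF awalkI_apath[OF p]] by simp_all
qed

lemma labeling_isometric:
  assumes "u \<in> pverts G" "v \<in> pverts G"
  shows "graph_dist (cayley \<Gamma> S) (\<phi> u) (\<phi> v) = graph_dist G u v"
proof (rule graph_dist_cayley_embedding[OF pair_sym_digraph_axioms group_\<Gamma> S_subset
      awalk_exists labeling_in_carrier _ _ assms])
  fix a b assume ab: "(a, b) \<in> parcs G"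
  \<comment> \<open>Both sides have the value \<open>f b - f r\<close> under each
    functional.\<close>
  have "\<phi> b = \<phi> a \<otimes>\<^bsub>\<Gamma>\<^esub> arc_label (a, b)"
    using ab in_arcsD1[OF ab] in_arcsD2[OF ab]
    by (intro functionals_separate)
      (simp_all add: labeling_in_carrier functional_labeling arc_label_in_carrier functional_arc_label
        functional_mult \<Gamma>.m_closed)
  then show "\<exists>s\<in>S \<union> m_inv \<Gamma> ` S. \<phi> b = \<phi> a \<otimes>\<^bsub>\<Gamma>\<^esub> s"
    using arc_label_in_S[OF ab] by blast
next
  fix f :: "'a \<Rightarrow> int"
  assume f: "\<And>a b. (a, b) \<in> parcs G \<Longrightarrow> \<bar>f b - f a\<bar> \<le> 1"
  \<comment> \<open>On a generator the functional is the difference of \<open>f\<close> along a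
    forward arc.\<close>
  have "\<bar>functional f s\<bar> \<le> 1" if "s \<in> S" for s
  proof -
    obtain j where j: "j < t" "s = g j"
      using \<open>s \<in> S\<close> by (auto simp: nonzero_gens_def)
    then have "(fst (\<alpha> j), snd (\<alpha> j)) \<in> parcs G"
      using \<alpha>_in_D D_subset by auto
    with f j show ?thesis by (simp add: functional_gen)
  qed
  then show "\<exists>L\<in>hom \<Gamma> integer_group. (\<forall>s\<in>S. \<bar>L s\<bar> \<le> 1) \<and>
      (\<forall>a\<in>pverts G. \<forall>b\<in>pverts G. L (\<phi> b) - L (\<phi> a) = f b - f a)"
    by (intro bexI[of _ "functional f"]) (simp_all add: functional_labeling functional_hom)
qed

text \<open>The isomorphism sends a chain to the coordinates of its boundary away from the root; the
  remaining coordinate is determined because the coordinates of a boundary sum to zero.\<close>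

lemma \<Gamma>_iso_free: "\<Gamma> \<cong> int_power {..<card (pverts G) - 1}"
proof -
  define m where "m = card (pverts G) - 1"
  have "card (pverts G - {r}) = m"
    using root pair_finite_verts by (simp add: m_def)
  then obtain \<epsilon> where \<epsilon>: "bij_betw \<epsilon> {..<m} (pverts G - {r})"
    using ex_bij_betw_nat_finite[of "pverts G - {r}"] pair_finite_verts
    by (auto simp: atLeast0LessThan)
  define h where "h x = (\<lambda>i\<in>{..<m}. pairing (\<lambda>v. of_bool (v = \<epsilon> i)) x)" for x
  have "h \<in> hom Zt (int_power {..<m})"
  proof (rule homI)
    fix x y assume "x \<in> carrier Zt" "y \<in> carrier Zt"
    then show "h (x \<otimes>\<^bsub>Zt\<^esub> y) = h x \<otimes>\<^bsub>int_power {..<m}\<^esub> h y"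
      using hom_mult[OF pairing_hom, of x y]
      by (simp add: h_def mult_int_power[of "{..<m}"] restrict_def cong: if_cong)
  qed (simp add: h_def carrier_int_power)
  then interpret h: group_hom Zt "int_power {..<m}" h
    by (simp add: group_hom_def group_hom_axioms_def group_int_power)
  have "pairing f x = 0" if hx: "h x = (\<lambda>i\<in>{..<m}. 0)" for f x
  proof -
    let ?\<delta> = "\<lambda>w v. of_bool (v = w) :: int"
    have off_root: "pairing (?\<delta> w) x = 0" if w: "w \<in> pverts G - {r}" for w
    proof -
      obtain i where "i < m" "w = \<epsilon> i"
        using w \<epsilon> by (auto simp: bij_betw_def)
      with fun_cong[OF hx, of i] show ?thesis by (simp add: h_def)
    qed
    \<comment> \<open>Only the summand at the root survives in the expansion. The constant function
      1 has zero coboundary, which then forces this last coordinate to vanish.\<close>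
    have split: "pairing f' x = f' r * pairing (?\<delta> r) x" for f'
      using off_root root pair_finite_verts by (subst pairing_expand) (simp add: sum.remove[of _ r])
    have "pairing (?\<delta> r) x = pairing (\<lambda>_. 1) x"
      using split[of "\<lambda>_. 1"] by simp
    also have "\<dots> = 0"
      by (simp add: pairing_def)
    finally show ?thesis
      by (simp add: split[of f])
  qed
  moreover have "h x = (\<lambda>i\<in>{..<m}. 0)" if "\<And>f. pairing f x = 0" for x
    by (simp add: h_def that)
  ultimately have "h x = (\<lambda>i\<in>{..<m}. 0) \<longleftrightarrow> (\<forall>f. pairing f x = 0)" for x
    by blast
  then have kernel: "kernel Zt (int_power {..<m}) h = N"
    by (auto simp: kernel_def N_iff carrier_int_power one_int_power)
  have "y \<in> h ` carrier Zt" if "y \<in> extensional {..<m}" for y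
  proof -
    have "\<exists>x\<in>extensional {..<t}. \<phi> v = N #>\<^bsub>Zt\<^esub> x" if "v \<in> pverts G" for v
      using labeling_in_carrier[OF that] by (auto simp: carrier_\<Gamma>)
    \<comment> \<open>The chain \<open>x v\<close> represents the label of \<open>v\<close>; by
      \<open>px\<close> it behaves like a path from \<open>r\<close> to \<open>v\<close>, with
      boundary the difference of the two vertex indicators.\<close>
    then obtain x where x: "\<And>v. v \<in> pverts G \<Longrightarrow> x v \<in> extensional {..<t} \<and> \<phi> v = N #>\<^bsub>Zt\<^esub> x v"
      by metis
    have px: "pairing f (x v) = f v - f r" if "v \<in> pverts G" for f v
      using x[OF that] functional_labeling[OF that, of f] by (simp add: functional_coset)
    \<comment> \<open>Superposing these path-like chains with weights \<open>y i\<close> prescribes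
      the boundary freely at all vertices other than the root.\<close>
    define z where "z = (\<lambda>j\<in>{..<t}. \<Sum>i<m. y i * x (\<epsilon> i) j)"
    have \<epsilon>v: "\<epsilon> i \<in> pverts G" "\<epsilon> i \<noteq> r" if "i < m" for i
      using bij_betw_apply[OF \<epsilon>, of i] that by auto
    have "h z i = y i" if i: "i < m" for i
    proof -
      have "h z i = (\<Sum>l<m. y l * (of_bool (\<epsilon> l = \<epsilon> i) - of_bool (r = \<epsilon> i)))"
        using i by (simp add: h_def z_def pairing_restrict pairing_sum_scale px \<epsilon>v)
      also have "\<dots> = (\<Sum>l<m. if l = i then y l else 0)"
        using i \<epsilon>v(2)[OF i] bij_betw_imp_inj_on[OF \<epsilon>]
        by (intro sum.cong refl) (auto simp: inj_on_eq_iff)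
      finally show ?thesis using i by simp
    qed
    then have "y = h z"
      using that by (intro extensionalityI[of _ "{..<m}"]) (auto simp: h_def)
    then show ?thesis
      by (auto simp: carrier_int_power z_def)
  qed
  then have "h ` carrier Zt = carrier (int_power {..<m})"
    by (auto simp: carrier_int_power[of "{..<m}"] h_def)
  from h.FactGroup_iso[OF this] show ?thesis
    unfolding kernel unfolding univ_group_def m_def .
qed

end

text \<open>Take for \<open>\<alpha> j\<close> the forward traversal of the only edge in class
  \<open>j\<close>. Distinct classes give distinct arcs, and every forward arc occurs because the
  classes cover all edges and its reversal is not forward.\<close>

lemma singleton_partition_exists:
  assumes "pair_graph G" "connected (with_proj G)" "oriented_partition G t F D"
    and "all_singleton t F" "integral_cycle_basis G D c B" "r \<in> pverts G"
  obtains \<alpha> where "singleton_partition G D \<alpha> t F c B r"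
proof -
  interpret pair_graph G by fact
  have part: "partition_on (edges G) (F ` {..<t})" "inj_on F {..<t}" and ori: "orientation G D"
    using assms(3) by (auto simp: oriented_partition_def)
  have D: "D \<subseteq> parcs G" "\<And>u v. (u, v) \<in> parcs G \<Longrightarrow> (u, v) \<in> D \<longleftrightarrow> (v, u) \<notin> D"
    using ori by (auto simp: orientation_def)
  have "\<exists>a\<in>D. F j = {edge_of a}" if j: "j < t" for j
  proof -
    obtain e where e: "F j = {e}"
      using assms(4) j by (auto simp: all_singleton_def is_singleton_def)
    then have "e \<in> edges G"
      using part(1) j by (force simp: partition_on_def)
    then obtain u v where uv: "(u, v) \<in> parcs G" "e = edge_of (u, v)"
      by (auto simp: edges_def)
    moreover have "edge_of (u, v) = edge_of (v, u)"
      by (auto simp: edge_of_def)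
    ultimately show ?thesis
      using D(2)[OF uv(1)] e by metis
  qed
  then obtain \<alpha> where \<alpha>: "\<And>j. j < t \<Longrightarrow> \<alpha> j \<in> D \<and> F j = {edge_of (\<alpha> j)}"
    by metis
  have "inj_on \<alpha> {..<t}"
    using part(2) \<alpha> by (intro inj_onI) (metis inj_onD lessThan_iff)
  moreover have "a \<in> \<alpha> ` {..<t}" if a: "a \<in> D" for a
  proof -
    have "edge_of a \<in> \<Union> (F ` {..<t})"
      using part(1) a D(1) by (auto simp: partition_on_def edges_def)
    then obtain j where j: "j < t" "edge_of a = edge_of (\<alpha> j)"
      using \<alpha> by auto
    have "\<alpha> j = a \<or> \<alpha> j = (snd a, fst a)"
      using j(2) by (cases a; cases "\<alpha> j") (auto simp: edge_of_def doubleton_eq_iff)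
    moreover have "(snd a, fst a) \<notin> D"
      using a D(1) D(2)[of "fst a" "snd a"] by auto
    ultimately show ?thesis
      using \<alpha>[OF j(1)] j(1) by auto
  qed
  ultimately have "bij_betw \<alpha> {..<t} D"
    using \<alpha> by (auto simp: bij_betw_def)
  with assms ori \<alpha> show thesis
    by (intro that[of \<alpha>]) (simp add: singleton_partition_def singleton_partition_axioms_def)
qed

text \<open>An identification of \<open>\<Gamma>\<close> with the free group is not canonical, so
  the isometry is stated in \<open>\<Gamma>\<close> itself and also after transport along an
  arbitrary isomorphism.\<close>

theorem lemma4:
  fixes G :: "'a pair_pre_digraph"
    and D :: "('a \<times> 'a) set"
    and F :: "nat \<Rightarrow> 'a set set"
    and B :: "nat \<Rightarrow> ('a \<times> 'a) list"
    and n t c :: nat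
    and r :: 'a
  assumes "pair_graph G"
    and "connected (with_proj G)"
    and "card (pverts G) = n"
    and "oriented_partition G t F D"
    and "all_singleton t F"
    and "integral_cycle_basis G D c B"
    and "r \<in> pverts G"
  shows
    "let A = cycle_class_matrix D F B;
         \<Gamma> = univ_group c t A;
         g = univ_gen c t A;
         \<phi> = quotient_labeling G D t F \<Gamma> g r;
         S = nonzero_gens t \<Gamma> g;
         Zn = int_power {..<n - 1}
     in \<Gamma> \<cong> Zn \<and>
        (\<forall>u\<in>pverts G. \<forall>v\<in>pverts G.
           graph_dist (cayley \<Gamma> S) (\<phi> u) (\<phi> v) = graph_dist G u v) \<and>
        (\<forall>\<psi>\<in>iso \<Gamma> Zn. \<forall>u\<in>pverts G. \<forall>v\<in>pverts G.
           graph_dist (cayley Zn (\<psi> ` S)) (\<psi> (\<phi> u)) (\<psi> (\<phi> v)) = graph_dist G u v)"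
proof -
  obtain \<alpha> where "singleton_partition G D \<alpha> t F c B r"
    using singleton_partition_exists assms by metis
  then interpret singleton_partition G D \<alpha> t F c B r .
  have "graph_dist (cayley (int_power I) (\<psi> ` S)) (\<psi> (\<phi> u)) (\<psi> (\<phi> v)) = graph_dist G u v"
    if "\<psi> \<in> iso \<Gamma> (int_power I)" "u \<in> pverts G" "v \<in> pverts G" for \<psi> u v and I :: "nat set"
    using graph_dist_cayley_iso[OF group_\<Gamma> group_int_power that(1) S_subset]
    by (simp add: that labeling_in_carrier labeling_isometric)
  then show ?thesis
    using \<Gamma>_iso_free labeling_isometric assms(3) by (simp add: Let_def)
qed

end
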